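(* $\Delta_2^0\not\subseteq \mathrm{F_{PR}}\text{-compressible}'$; that is, there exists a set in $\Delta_2^0$ that is infinite and is not $\mathrm{F_{PR}}$-compressible.
   Context: $\Sigma=\{0,1\}$. $\Delta_2^0$ is the class of sets $A\subseteq\Sigma^\ast$ that are Turing reducible to some recursively enumerable set. $\mathrm{F_{PR}}$ is the class of partial recursive functions $\Sigma^\ast\to\Sigma^\ast$. A (possibly partial) function $f$ is a compression function for $A$ if $f$ is defined on all of $A$, $f(A)=\Sigma^\ast$, and $f$ is injective on $A$ (no condition outside $A$); $A$ is $\mathrm{F_{PR}}$-compressible if it has a compression function in $\mathrm{F_{PR}}$. $\mathrm{F_{PR}}\text{-compressible}'$ denotes the class of all $\mathrm{F_{PR}}$-compressible sets together with all finite subsets of $\Sigma^\ast$. *)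

theory Defs
  imports Main
begin

text \<open>
  Partial functions of several natural-number arguments are rendered as \<open>nat list \<Rightarrow> nat option\<close>;
  an \<open>n\<close>-ary function is only meaningful on argument lists of length \<open>n\<close>, its values on lists of
  any other length are junk.
\<close>

text \<open>Composition is strict: it is undefined as soon as one of the inner values is.\<close>

definition comp_fun :: "(nat list \<Rightarrow> nat option) \<Rightarrow> (nat list \<Rightarrow> nat option) list \<Rightarrow> nat list \<Rightarrow> nat option"
  where "comp_fun f gs xs = Option.bind (those (map (\<lambda>g. g xs) gs)) f"

primrec prim_rec_fun ::
  "(nat list \<Rightarrow> nat option) \<Rightarrow> (nat list \<Rightarrow> nat option) \<Rightarrow> nat \<Rightarrow> nat list \<Rightarrow> nat option"
  where
    "prim_rec_fun f g 0 xs = f xs"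
  | "prim_rec_fun f g (Suc n) xs = Option.bind (prim_rec_fun f g n xs) (\<lambda>r. g (n # r # xs))"

text \<open>The search diverges if an undefined value is met before the first zero.\<close>

definition mu_fun :: "(nat list \<Rightarrow> nat option) \<Rightarrow> nat list \<Rightarrow> nat option"
  where "mu_fun f xs =
    (if \<exists>n. f (n # xs) = Some 0 \<and> (\<forall>m<n. f (m # xs) \<noteq> None)
     then Some (LEAST n. f (n # xs) = Some 0) else None)"

text \<open>
  Kleene's schemes: \<open>partial_rec_in \<Phi> n f\<close> says that the \<open>n\<close>-ary \<open>f\<close> is partial recursive in the
  total unary functions \<open>\<Phi>\<close>. With \<open>\<Phi> = {}\<close> the oracle scheme never applies and these are the
  partial recursive functions.
\<close>

inductive partial_rec_in :: "(nat \<Rightarrow> nat) set \<Rightarrow> nat \<Rightarrow> (nat list \<Rightarrow> nat option) \<Rightarrow> bool"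
  for \<Phi> :: "(nat \<Rightarrow> nat) set"
  where
    zero: "partial_rec_in \<Phi> n (\<lambda>xs. Some 0)"
  | succ: "partial_rec_in \<Phi> 1 (\<lambda>xs. Some (Suc (hd xs)))"
  | proj: "i < n \<Longrightarrow> partial_rec_in \<Phi> n (\<lambda>xs. Some (xs ! i))"
  | oracle_call: "h \<in> \<Phi> \<Longrightarrow> partial_rec_in \<Phi> 1 (\<lambda>xs. Some (h (hd xs)))"
  | comp: "partial_rec_in \<Phi> (length gs) f \<Longrightarrow> \<forall>g \<in> set gs. partial_rec_in \<Phi> n g
      \<Longrightarrow> partial_rec_in \<Phi> n (comp_fun f gs)"
  | prim_rec: "partial_rec_in \<Phi> n f \<Longrightarrow> partial_rec_in \<Phi> (n + 2) g
      \<Longrightarrow> partial_rec_in \<Phi> (n + 1) (\<lambda>xs. prim_rec_fun f g (hd xs) (tl xs))"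
  | mu: "partial_rec_in \<Phi> (n + 1) f \<Longrightarrow> partial_rec_in \<Phi> n (mu_fun f)"

type_synonym word = "bool list"

text \<open>
  The usual identification of words over \<open>{0, 1}\<close> with natural numbers: the rank of a word in the
  length-lexicographic order (\<open>\<epsilon>, 0, 1, 00, 01, \<dots>\<close> are sent to \<open>0, 1, 2, 3, 4, \<dots>\<close>).
\<close>

definition word_rank :: "word \<Rightarrow> nat"
  where "word_rank w = foldl (\<lambda>n b. 2 * n + (if b then 2 else 1)) 0 w"

lemma word_rank_Nil [simp]: "word_rank [] = 0"
  by (simp add: word_rank_def)

lemma word_rank_snoc [simp]: "word_rank (w @ [b]) = 2 * word_rank w + (if b then 2 else 1)"
  by (simp add: word_rank_def)

lemma bij_word_rank: "bij word_rank"
proof (rule bijI)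
  show "inj word_rank"
  proof (rule injI)
    fix v w :: word
    assume "word_rank v = word_rank w"
    then show "v = w"
    proof (induction v arbitrary: w rule: rev_induct)
      case Nil
      then show ?case by (cases w rule: rev_cases) (auto split: if_splits)
    next
      case (snoc b v)
      show ?case
      proof (cases w rule: rev_cases)
        case Nil
        with snoc.prems show ?thesis by (auto split: if_splits)
      next
        case (snoc u c)
        with snoc.prems have eq: "2 * word_rank v + (if b then 2 else 1)
            = 2 * word_rank u + (if c then 2 else 1)"
          by simp
        then have "b = c" "word_rank v = word_rank u"
          by (auto split: if_splits; presburger)+
        with snoc.IH snoc show ?thesis by simp
      qed
    qed
  qed
next
  have "\<exists>w. word_rank w = n" for n
  proof (induction n rule: less_induct)
    case (less n)
    show ?case
    proof (cases "n = 0")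
      case True
      then show ?thesis by (intro exI [of _ "[]"]) simp
    next
      case False
      then have "(n - 1) div 2 < n" by auto
      with less obtain w where "word_rank w = (n - 1) div 2" by blast
      with False show ?thesis
        by (intro exI [of _ "w @ [even n]"]) (auto elim!: evenE oddE)
    qed
  qed
  then show "surj word_rank" by (metis surjI)
qed

definition F_PR :: "(word \<Rightarrow> word option) set"
  where "F_PR =
    {f. \<exists>\<phi>. partial_rec_in {} 1 \<phi> \<and> (\<forall>w. \<phi> [word_rank w] = map_option word_rank (f w))}"

definition rec_enumerable :: "word set \<Rightarrow> bool"
  where "rec_enumerable A \<longleftrightarrow> (\<exists>f \<in> F_PR. dom f = A)"

definition char_fun :: "word set \<Rightarrow> nat \<Rightarrow> nat"
  where "char_fun A n = (if n \<in> word_rank ` A then 1 else 0)"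

definition turing_reducible :: "word set \<Rightarrow> word set \<Rightarrow> bool"  (infix \<open>\<le>\<^sub>T\<close> 50)
  where "A \<le>\<^sub>T B \<longleftrightarrow> (\<exists>\<phi>. partial_rec_in {char_fun B} 1 \<phi> \<and> (\<forall>n. \<phi> [n] = Some (char_fun A n)))"

definition Delta_2_0 :: "word set set"
  where "Delta_2_0 = {A. \<exists>B. rec_enumerable B \<and> A \<le>\<^sub>T B}"

definition compression_function :: "(word \<Rightarrow> word option) \<Rightarrow> word set \<Rightarrow> bool"
  where "compression_function f A \<longleftrightarrow> A \<subseteq> dom f \<and> f ` A = range Some \<and> inj_on f A"

definition compressible :: "(word \<Rightarrow> word option) set \<Rightarrow> word set \<Rightarrow> bool"
  where "compressible F A \<longleftrightarrow> (\<exists>f \<in> F. compression_function f A)"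

definition compressible' :: "(word \<Rightarrow> word option) set \<Rightarrow> word set set"
  where "compressible' F = {A. compressible F A} \<union> {A. finite A}"

end

theory Submission
  imports Defs "HOL-Library.Nat_Bijection"
begin

text \<open>
  The set is built in stages, stage \<open>e\<close> deciding membership from some number \<open>b\<close> up to the next
  bound and defeating the \<open>e\<close>-th partial recursive function \<open>f\<close>. If \<open>f\<close> takes a value twice, at
  \<open>b \<le> x < y\<close>, then all of \<open>{b..y}\<close> is put into the set and \<open>f\<close> is not injective on it. Otherwise
  \<open>f\<close> is injective from \<open>b\<close> on; of \<open>{b..2 b}\<close> exactly the points where \<open>f\<close> diverges are put into
  the set, and \<open>2 b + 1\<close> is added to make it infinite. If there are no such points, one of the
  \<open>b + 1\<close> values on \<open>{b..2 b}\<close> is not taken below \<open>b\<close>, hence nowhere on the set. Only the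
  questions whether \<open>f\<close> has a collision and whether it converges need an oracle, and both are
  recursively enumerable.
\<close>

section \<open>Total functions recursive in an oracle\<close>

definition total_rec :: "(nat \<Rightarrow> nat) set \<Rightarrow> nat \<Rightarrow> (nat list \<Rightarrow> nat) \<Rightarrow> bool"
  where "total_rec \<Phi> n F \<longleftrightarrow>
    (\<exists>\<phi>. partial_rec_in \<Phi> n \<phi> \<and> (\<forall>xs. length xs = n \<longrightarrow> \<phi> xs = Some (F xs)))"

definition decidable :: "(nat \<Rightarrow> nat) set \<Rightarrow> nat \<Rightarrow> (nat list \<Rightarrow> bool) \<Rightarrow> bool"
  where "decidable \<Phi> n P \<longleftrightarrow> total_rec \<Phi> n (\<lambda>xs. if P xs then 1 else 0)"

text \<open>Closure rules that, applied backwards along the syntax of a HOL term, show it recursive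
  without exhibiting a chain of Kleene schemes.\<close>

named_theorems rec_intros

lemma total_rec_cong:
  "(\<And>xs. length xs = n \<Longrightarrow> F xs = G xs) \<Longrightarrow> total_rec \<Phi> n F \<longleftrightarrow> total_rec \<Phi> n G"
  by (simp add: total_rec_def)

lemma total_rec_nth [rec_intros]: "i < n \<Longrightarrow> total_rec \<Phi> n (\<lambda>xs. xs ! i)"
  unfolding total_rec_def using partial_rec_in.proj by blast

text \<open>Rules that go under a binder put the bound variables in front of the argument list, so
  that an original argument turns up as an entry of \<open>drop k xs\<close>.\<close>

lemma total_rec_drop_nth [rec_intros]:
  assumes "k + i < n"
  shows "total_rec \<Phi> n (\<lambda>xs. drop k xs ! i)"
  using total_rec_nth [OF assms] by (rule total_rec_cong [THEN iffD1, rotated]) (use assms in simp)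

lemma those_map_Some: "\<forall>g \<in> set gs. h g = Some (k g) \<Longrightarrow> those (map h gs) = Some (map k gs)"
  by (induction gs) auto

lemma total_rec_comp:
  assumes "total_rec \<Phi> (length gs) F" "\<forall>g \<in> set gs. total_rec \<Phi> n g"
  shows "total_rec \<Phi> n (\<lambda>xs. F (map (\<lambda>g. g xs) gs))"
proof -
  obtain \<phi> where \<phi>: "partial_rec_in \<Phi> (length gs) \<phi>" "\<And>xs. length xs = length gs \<Longrightarrow> \<phi> xs = Some (F xs)"
    using assms(1) by (auto simp: total_rec_def)
  obtain \<psi> where \<psi>: "\<forall>g \<in> set gs. partial_rec_in \<Phi> n (\<psi> g) \<and>
      (\<forall>xs. length xs = n \<longrightarrow> \<psi> g xs = Some (g xs))"
    using bchoice [OF assms(2)[unfolded total_rec_def]] by blast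
  have "partial_rec_in \<Phi> n (comp_fun \<phi> (map \<psi> gs))"
    using \<phi>(1) \<psi> by (intro partial_rec_in.comp) auto
  moreover have "comp_fun \<phi> (map \<psi> gs) xs = Some (F (map (\<lambda>g. g xs) gs))" if "length xs = n" for xs
  proof -
    have "those (map (\<lambda>g. \<psi> g xs) gs) = Some (map (\<lambda>g. g xs) gs)"
      using \<psi> that by (intro those_map_Some) auto
    then show ?thesis by (simp add: comp_fun_def \<phi>(2) comp_def)
  qed
  ultimately show ?thesis by (auto simp: total_rec_def)
qed

lemma total_rec_comp1:
  assumes "total_rec \<Phi> 1 (\<lambda>xs. f (xs ! 0))" "total_rec \<Phi> n a"
  shows "total_rec \<Phi> n (\<lambda>xs. f (a xs))"
  using total_rec_comp [of \<Phi> "[a]" "\<lambda>xs. f (xs ! 0)" n] assms by simp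

lemma total_rec_comp2:
  assumes "total_rec \<Phi> 2 (\<lambda>xs. f (xs ! 0) (xs ! 1))" "total_rec \<Phi> n a" "total_rec \<Phi> n b"
  shows "total_rec \<Phi> n (\<lambda>xs. f (a xs) (b xs))"
  using total_rec_comp [of \<Phi> "[a, b]" "\<lambda>xs. f (xs ! 0) (xs ! 1)" n] assms
  by (simp add: numeral_2_eq_2)

lemma total_rec_Suc [rec_intros]:
  assumes "total_rec \<Phi> n a"
  shows "total_rec \<Phi> n (\<lambda>xs. Suc (a xs))"
proof (rule total_rec_comp1 [OF _ assms])
  show "total_rec \<Phi> 1 (\<lambda>xs. Suc (xs ! 0))"
    unfolding total_rec_def using partial_rec_in.succ
    by (intro exI [of _ "\<lambda>xs. Some (Suc (hd xs))"]) (auto simp: length_Suc_conv)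
qed

text \<open>Not in \<open>rec_intros\<close>: the conclusion unifies with every goal.\<close>

lemma total_rec_oracle:
  assumes "h \<in> \<Phi>" "total_rec \<Phi> n a"
  shows "total_rec \<Phi> n (\<lambda>xs. h (a xs))"
proof (rule total_rec_comp1 [OF _ assms(2)])
  show "total_rec \<Phi> 1 (\<lambda>xs. h (xs ! 0))"
    unfolding total_rec_def using partial_rec_in.oracle_call [OF assms(1)]
    by (intro exI [of _ "\<lambda>xs. Some (h (hd xs))"]) (auto simp: length_Suc_conv)
qed

lemma total_rec_const [rec_intros]: "total_rec \<Phi> n (\<lambda>xs. c)"
proof (induction c)
  case 0
  then show ?case unfolding total_rec_def using partial_rec_in.zero by blast
qed (rule total_rec_Suc)

lemma total_rec_rec_nat [rec_intros]:
  assumes "total_rec \<Phi> n a" "total_rec \<Phi> (n + 2) (\<lambda>ys. g (drop 2 ys) (ys ! 0) (ys ! 1))"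
    "total_rec \<Phi> n m"
  shows "total_rec \<Phi> n (\<lambda>xs. rec_nat (a xs) (g xs) (m xs))"
proof -
  let ?R = "\<lambda>xs. rec_nat (a (tl xs)) (g (tl xs)) (hd xs)"
  obtain \<phi> where \<phi>: "partial_rec_in \<Phi> n \<phi>" "\<And>xs. length xs = n \<Longrightarrow> \<phi> xs = Some (a xs)"
    using assms(1) by (auto simp: total_rec_def)
  obtain \<gamma> where \<gamma>: "partial_rec_in \<Phi> (n + 2) \<gamma>"
    "\<And>xs. length xs = n + 2 \<Longrightarrow> \<gamma> xs = Some (g (drop 2 xs) (xs ! 0) (xs ! 1))"
    using assms(2) by (auto simp: total_rec_def)
  have "prim_rec_fun \<phi> \<gamma> k xs = Some (rec_nat (a xs) (g xs) k)" if "length xs = n" for k xs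
    using that by (induction k) (simp_all add: \<phi>(2) \<gamma>(2))
  then have "total_rec \<Phi> (n + 1) ?R"
    unfolding total_rec_def using partial_rec_in.prim_rec [OF \<phi>(1) \<gamma>(1)]
    by (intro exI [of _ "\<lambda>xs. prim_rec_fun \<phi> \<gamma> (hd xs) (tl xs)"]) auto
  \<comment> \<open>The counter is replaced by \<open>m xs\<close>; the \<open>n\<close> projections
    pass on the parameters.\<close>
  then have *: "total_rec \<Phi> n (\<lambda>xs. ?R (map (\<lambda>h. h xs) (m # map (\<lambda>i xs. xs ! i) [0..<n])))"
    using assms(3) by (intro total_rec_comp) (auto intro: total_rec_nth)
  have "map ((\<lambda>h. h xs) \<circ> (\<lambda>i xs. xs ! i)) [0..<n] = xs" if "length xs = n" for xs :: "nat list"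
    using map_nth [of xs] that by (simp add: comp_def)
  then show ?thesis
    using * by (subst total_rec_cong) (auto simp: comp_def)
qed

lemma total_rec_add [rec_intros]:
  assumes "total_rec \<Phi> n a" "total_rec \<Phi> n b"
  shows "total_rec \<Phi> n (\<lambda>xs. a xs + b xs)"
proof -
  have "a + b = rec_nat b (\<lambda>k. Suc) a" for a b :: nat by (induction a) auto
  then have "(\<lambda>xs. a xs + b xs) = (\<lambda>xs. rec_nat (b xs) (\<lambda>k. Suc) (a xs))" by blast
  then show ?thesis by (simp only:) (intro rec_intros assms; simp)
qed

lemma total_rec_pred [rec_intros]:
  assumes "total_rec \<Phi> n a"
  shows "total_rec \<Phi> n (\<lambda>xs. a xs - Suc 0)"
proof -
  have "a - Suc 0 = rec_nat 0 (\<lambda>k r. k) a" for a :: nat by (cases a) auto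
  then show ?thesis by (simp only:) (intro rec_intros assms; simp)
qed

lemma total_rec_diff [rec_intros]:
  assumes "total_rec \<Phi> n a" "total_rec \<Phi> n b"
  shows "total_rec \<Phi> n (\<lambda>xs. a xs - b xs)"
proof -
  have "a - b = rec_nat a (\<lambda>k r. r - Suc 0) b" for a b :: nat by (induction b) auto
  then have "(\<lambda>xs. a xs - b xs) = (\<lambda>xs. rec_nat (a xs) (\<lambda>k r. r - Suc 0) (b xs))" by blast
  then show ?thesis by (simp only:) (intro rec_intros assms; simp)
qed

lemma total_rec_if [rec_intros]:
  assumes "decidable \<Phi> n P" "total_rec \<Phi> n a" "total_rec \<Phi> n b"
  shows "total_rec \<Phi> n (\<lambda>xs. if P xs then a xs else b xs)"
proof -
  \<comment> \<open>Primitive recursion on the indicator of \<open>P\<close>: no round leaves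
    \<open>b xs\<close>, one round yields \<open>a xs\<close>.\<close>
  have *: "(\<lambda>xs. if P xs then a xs else b xs) =
      (\<lambda>xs. rec_nat (b xs) (\<lambda>k r. a xs) (if P xs then 1 else 0))"
    by auto
  \<comment> \<open>The recursion step sees the counter and the previous value in front of
    \<open>xs\<close>; projections skip these two.\<close>
  have shift: "total_rec \<Phi> (n + 2) (\<lambda>ys. f (drop 2 ys))" if f: "total_rec \<Phi> n f" for f
  proof -
    have "total_rec \<Phi> (n + 2) (\<lambda>ys. f (map (\<lambda>h. h ys) (map (\<lambda>i xs. xs ! (i + 2)) [0..<n])))"
      using f by (intro total_rec_comp) (auto intro: total_rec_nth)
    moreover have "map ((\<lambda>h. h ys) \<circ> (\<lambda>i xs. xs ! (i + 2))) [0..<n] = drop 2 ys"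
      if "length ys = n + 2" for ys :: "nat list"
      using that by (intro nth_equalityI) (auto simp: add.commute)
    ultimately show ?thesis by (subst total_rec_cong) (auto simp: comp_def)
  qed
  show ?thesis
    unfolding * by (intro rec_intros shift assms assms(1)[unfolded decidable_def])
qed

section \<open>Closure properties of the decidable predicates\<close>

lemma decidable_not [rec_intros]:
  assumes "decidable \<Phi> n P" shows "decidable \<Phi> n (\<lambda>xs. \<not> P xs)"
proof -
  have "(if \<not> P xs then 1 else 0) = (if P xs then 0 else (1::nat))" for xs
    by simp
  then show ?thesis unfolding decidable_def by (simp only:) (intro rec_intros assms)
qed

lemma decidable_conj [rec_intros]:
  assumes "decidable \<Phi> n P" "decidable \<Phi> n Q" shows "decidable \<Phi> n (\<lambda>xs. P xs \<and> Q xs)"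
proof -
  have "(if P xs \<and> Q xs then 1 else 0) = (if P xs then if Q xs then 1 else 0 else (0::nat))" for xs
    by simp
  then show ?thesis unfolding decidable_def by (simp only:) (intro rec_intros assms)
qed

lemma decidable_disj [rec_intros]:
  assumes "decidable \<Phi> n P" "decidable \<Phi> n Q" shows "decidable \<Phi> n (\<lambda>xs. P xs \<or> Q xs)"
proof -
  have "(P xs \<or> Q xs) = (\<not> (\<not> P xs \<and> \<not> Q xs))" for xs
    by simp
  then show ?thesis by (simp only:) (intro rec_intros assms)
qed

lemma decidable_le [rec_intros]:
  assumes "total_rec \<Phi> n a" "total_rec \<Phi> n b" shows "decidable \<Phi> n (\<lambda>xs. a xs \<le> b xs)"
proof -
  have "(if a \<le> b then 1 else 0) = 1 - (a - b)" for a b :: nat by simp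
  then show ?thesis unfolding decidable_def by (simp only:) (intro rec_intros assms)
qed

lemma decidable_less [rec_intros]:
  assumes "total_rec \<Phi> n a" "total_rec \<Phi> n b" shows "decidable \<Phi> n (\<lambda>xs. a xs < b xs)"
  unfolding Suc_le_eq [symmetric] by (intro rec_intros assms)

lemma decidable_eq [rec_intros]:
  assumes "total_rec \<Phi> n a" "total_rec \<Phi> n b" shows "decidable \<Phi> n (\<lambda>xs. a xs = b xs)"
  unfolding eq_iff by (intro rec_intros assms)

text \<open>The quantifier is a primitive recursion whose value jumps to 1 at each witness; of the
  two new arguments, \<open>ys ! 0\<close> is the counter and \<open>ys ! 1\<close> the value so
  far.\<close>

lemma decidable_Ex_less [rec_intros]:
  assumes "decidable \<Phi> (n + 2) (\<lambda>ys. P (drop 2 ys) (ys ! 0))" "total_rec \<Phi> n m"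
  shows "decidable \<Phi> n (\<lambda>xs. \<exists>k<m xs. P xs k)"
proof -
  have "rec_nat 0 (\<lambda>k r. if Q k then 1 else r) m = (if \<exists>k<m. Q k then 1 else (0::nat))" for Q m
    by (induction m) (auto simp: less_Suc_eq)
  then have "(\<lambda>xs. if \<exists>k<m xs. P xs k then 1 else (0::nat)) =
      (\<lambda>xs. rec_nat 0 (\<lambda>k r. if P xs k then 1 else r) (m xs))"
    by simp
  then show ?thesis unfolding decidable_def by (simp only:) (intro rec_intros assms; simp)
qed

text \<open>Minimization looks for a zero, so it is applied to the reversed indicator of
  \<open>P\<close>. That function is total, hence the search cannot diverge before its first
  zero.\<close>

lemma partial_rec_search:
  assumes "decidable \<Phi> (n + 1) (\<lambda>ys. P (drop 1 ys) (ys ! 0))"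
  obtains \<phi> where "partial_rec_in \<Phi> n \<phi>"
    "\<And>xs. length xs = n \<Longrightarrow> \<phi> xs = (if \<exists>k. P xs k then Some (LEAST k. P xs k) else None)"
proof -
  have "total_rec \<Phi> (n + 1) (\<lambda>ys. if P (drop 1 ys) (ys ! 0) then 0 else 1)"
    by (intro rec_intros assms)
  then obtain \<psi> where \<psi>: "partial_rec_in \<Phi> (n + 1) \<psi>"
      "\<And>ys. length ys = n + 1 \<Longrightarrow> \<psi> ys = Some (if P (drop 1 ys) (ys ! 0) then 0 else 1)"
    by (auto simp: total_rec_def)
  have "mu_fun \<psi> xs = (if \<exists>k. P xs k then Some (LEAST k. P xs k) else None)" if "length xs = n" for xs
    using that by (simp add: mu_fun_def \<psi>(2))
  with partial_rec_in.mu [OF \<psi>(1)] show ?thesis using that by blast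
qed

lemma total_rec_Least [rec_intros]:
  assumes "decidable \<Phi> (n + 1) (\<lambda>ys. P (drop 1 ys) (ys ! 0))" "\<And>xs. \<exists>k. P xs k"
  shows "total_rec \<Phi> n (\<lambda>xs. LEAST k. P xs k)"
  using partial_rec_search [where P = P, OF assms(1)] assms(2) unfolding total_rec_def by metis

section \<open>Pairs and lists of numbers\<close>

definition pair :: "nat \<Rightarrow> nat \<Rightarrow> nat" where "pair x y = prod_encode (x, y)"
definition pfst :: "nat \<Rightarrow> nat" where "pfst n = fst (prod_decode n)"
definition psnd :: "nat \<Rightarrow> nat" where "psnd n = snd (prod_decode n)"

lemma pfst_pair [simp]: "pfst (pair x y) = x" and psnd_pair [simp]: "psnd (pair x y) = y"
  and pair_collapse [simp]: "pair (pfst n) (psnd n) = n"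
  and pair_inject [simp]: "pair x y = pair x' y' \<longleftrightarrow> x = x' \<and> y = y'"
  by (simp_all add: pair_def pfst_def psnd_def)

lemma le_pair_2: "y \<le> pair x y"
  by (simp add: pair_def le_prod_encode_2)

lemma total_rec_triangle:
  assumes "total_rec \<Phi> n a"
  shows "total_rec \<Phi> n (\<lambda>xs. triangle (a xs))"
proof -
  have "triangle m = rec_nat 0 (\<lambda>k r. r + Suc k) m" for m by (induction m) auto
  then show ?thesis by (simp only:) (intro rec_intros assms; simp)
qed

lemma total_rec_pair [rec_intros]:
  assumes "total_rec \<Phi> n a" "total_rec \<Phi> n b"
  shows "total_rec \<Phi> n (\<lambda>xs. pair (a xs) (b xs))"
  unfolding pair_def prod_encode_def case_prod_conv by (intro rec_intros total_rec_triangle assms)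

text \<open>The index of the diagonal on which Cantor's enumeration of pairs meets its \<open>n\<close>-th pair.\<close>

definition diagonal :: "nat \<Rightarrow> nat"
  where "diagonal n = rec_nat 0 (\<lambda>k r. if triangle (Suc r) \<le> Suc k then Suc r else r) n"

lemma diagonal_bounds: "triangle (diagonal n) \<le> n \<and> n < triangle (Suc (diagonal n))"
  unfolding diagonal_def by (induction n) auto

text \<open>Position \<open>m\<close> on diagonal \<open>d\<close> of Cantor's enumeration carries
  the pair \<open>(m, d - m)\<close>. With \<open>d\<close> found by primitive recursion, decoding
  is seen to be recursive.\<close>

lemma prod_decode_diagonal:
  "prod_decode n = (n - triangle (diagonal n), diagonal n - (n - triangle (diagonal n)))"
proof -
  define m where "m = n - triangle (diagonal n)"
  have "n = triangle (diagonal n) + m" "m \<le> diagonal n"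
    using diagonal_bounds [of n] by (auto simp: m_def)
  \<comment> \<open>Since \<open>m\<close> does not exceed the index of the diagonal,
    \<open>prod_decode_aux\<close> stops at once.\<close>
  then have "prod_decode n = (m, diagonal n - m)"
    using prod_decode_triangle_add [of "diagonal n" m] by (subst (asm) prod_decode_aux.simps) simp
  then show ?thesis by (simp add: m_def)
qed

lemma total_rec_diagonal:
  assumes "total_rec \<Phi> n a"
  shows "total_rec \<Phi> n (\<lambda>xs. diagonal (a xs))"
  unfolding diagonal_def by (intro rec_intros total_rec_triangle assms; simp)

lemma total_rec_pfst [rec_intros]:
  assumes "total_rec \<Phi> n a"
  shows "total_rec \<Phi> n (\<lambda>xs. pfst (a xs))"
  unfolding pfst_def prod_decode_diagonal fst_conv
  by (intro rec_intros total_rec_triangle total_rec_diagonal assms)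

lemma total_rec_psnd [rec_intros]:
  assumes "total_rec \<Phi> n a"
  shows "total_rec \<Phi> n (\<lambda>xs. psnd (a xs))"
  unfolding psnd_def prod_decode_diagonal snd_conv
  by (intro rec_intros total_rec_triangle total_rec_diagonal assms)

section \<open>Lists of numbers in the coding of \<open>list_encode\<close>, with 0 for the empty
  list\<close>

definition ccons :: "nat \<Rightarrow> nat \<Rightarrow> nat" where "ccons x l = Suc (pair x l)"
definition chd :: "nat \<Rightarrow> nat" where "chd l = pfst (l - Suc 0)"
definition ctl :: "nat \<Rightarrow> nat" where "ctl l = psnd (l - Suc 0)"
definition cdrop :: "nat \<Rightarrow> nat \<Rightarrow> nat" where "cdrop k l = rec_nat l (\<lambda>i. ctl) k"
text \<open>The bound \<open>k<l\<close> makes the search bounded. It loses nothing, as each drop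
  decreases a nonzero code (\<open>cdrop_le\<close>).\<close>

definition cmem :: "nat \<Rightarrow> nat \<Rightarrow> bool"
  where "cmem x l \<longleftrightarrow> (\<exists>k<l. cdrop k l \<noteq> 0 \<and> chd (cdrop k l) = x)"

lemma total_rec_ccons [rec_intros]:
  assumes "total_rec \<Phi> n a" "total_rec \<Phi> n b"
  shows "total_rec \<Phi> n (\<lambda>xs. ccons (a xs) (b xs))"
  unfolding ccons_def by (intro rec_intros assms)

lemma total_rec_chd [rec_intros]:
  assumes "total_rec \<Phi> n a"
  shows "total_rec \<Phi> n (\<lambda>xs. chd (a xs))"
  unfolding chd_def by (intro rec_intros assms)

lemma total_rec_ctl [rec_intros]:
  assumes "total_rec \<Phi> n a"
  shows "total_rec \<Phi> n (\<lambda>xs. ctl (a xs))"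
  unfolding ctl_def by (intro rec_intros assms)

lemma total_rec_cdrop [rec_intros]:
  assumes "total_rec \<Phi> n a" "total_rec \<Phi> n b"
  shows "total_rec \<Phi> n (\<lambda>xs. cdrop (a xs) (b xs))"
  unfolding cdrop_def by (intro rec_intros assms; simp)

text \<open>With two plain arguments in place of \<open>a\<close> and \<open>b\<close>, the
  quantifier in \<open>cmem\<close> can be treated without shifting arbitrary terms.\<close>

lemma decidable_comp2:
  assumes "decidable \<Phi> 2 (\<lambda>xs. P (xs ! 0) (xs ! 1))" "total_rec \<Phi> n a" "total_rec \<Phi> n b"
  shows "decidable \<Phi> n (\<lambda>xs. P (a xs) (b xs))"
  using assms unfolding decidable_def by (rule total_rec_comp2)

lemma decidable_cmem [rec_intros]:
  assumes "total_rec \<Phi> n a" "total_rec \<Phi> n b"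
  shows "decidable \<Phi> n (\<lambda>xs. cmem (a xs) (b xs))"
  by (rule decidable_comp2 [OF _ assms]) (unfold cmem_def, intro rec_intros; simp)

lemma chd_ccons [simp]: "chd (ccons x l) = x" and ctl_ccons [simp]: "ctl (ccons x l) = l"
  and ccons_pos [simp]: "0 < ccons x l" and ccons_neq_0 [simp]: "ccons x l \<noteq> 0"
  and ccons_inject [simp]: "ccons x l = ccons x' l' \<longleftrightarrow> x = x' \<and> l = l'"
  by (simp_all add: chd_def ctl_def ccons_def)

lemma ccons_collapse [simp]: "l \<noteq> 0 \<Longrightarrow> ccons (chd l) (ctl l) = l"
  by (simp add: chd_def ctl_def ccons_def)

lemma list_encode_Cons [simp]: "list_encode (x # xs) = ccons x (list_encode xs)"
  by (simp add: ccons_def pair_def)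

declare list_encode.simps(2) [simp del]

lemma less_ccons: "l < ccons x l"
  by (simp add: ccons_def le_pair_2 less_Suc_eq_le)

lemma ctl_le: "ctl l \<le> l - 1"
  unfolding ctl_def psnd_def using le_prod_encode_2 by (metis One_nat_def prod.collapse prod_decode_inverse)

lemma cdrop_0 [simp]: "cdrop 0 l = l"
  by (simp add: cdrop_def)

lemma cdrop_Suc_ccons [simp]: "cdrop (Suc k) (ccons x l) = cdrop k l"
  by (induction k) (simp_all add: cdrop_def)

lemma cdrop_le: "cdrop k l \<le> l - k"
proof (induction k)
  case (Suc k)
  then show ?case using ctl_le [of "cdrop k l"] by (simp add: cdrop_def)
qed simp

lemma not_cmem_0 [simp]: "\<not> cmem x 0"
  by (simp add: cmem_def)

lemma cmem_ccons [simp]: "cmem x (ccons y l) \<longleftrightarrow> x = y \<or> cmem x l"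
proof
  assume "cmem x (ccons y l)"
  then obtain k where k: "k < ccons y l" "cdrop k (ccons y l) \<noteq> 0" "chd (cdrop k (ccons y l)) = x"
    by (auto simp: cmem_def)
  show "x = y \<or> cmem x l"
  proof (cases k)
    case (Suc i)
    with k have "i < l" using cdrop_le [of i l] by auto
    with Suc k show ?thesis by (auto simp: cmem_def)
  qed (use k in auto)
next
  assume "x = y \<or> cmem x l"
  then show "cmem x (ccons y l)"
  proof
    assume "cmem x l"
    then obtain k where "k < l" "cdrop k l \<noteq> 0" "chd (cdrop k l) = x"
      by (auto simp: cmem_def)
    with less_ccons [of l y] show ?thesis
      unfolding cmem_def by (intro exI [of _ "Suc k"]) auto
  qed (use less_ccons [of l y] in \<open>auto simp: cmem_def intro!: exI [of _ 0]\<close>)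
qed

lemma chd_cdrop: "i < length xs \<Longrightarrow> chd (cdrop i (list_encode xs)) = xs ! i"
  by (induction xs arbitrary: i) (auto simp: nth_Cons split: nat.split)

section \<open>A universal relation\<close>

text \<open>
  The index \<open>pair t p\<close> carries the scheme in its tag \<open>t\<close>: zero, successor, projection, composition,
  primitive recursion and minimization have the tags 0, 1, 2, 3, 5 and 6. Two auxiliary tags keep
  each rule down to two premises: 4 evaluates a list of indices on the same arguments, and 7 says
  that the values at all numbers below the first argument are defined and positive.
\<close>

definition justified :: "(nat \<Rightarrow> nat \<Rightarrow> nat \<Rightarrow> bool) \<Rightarrow> nat \<Rightarrow> nat \<Rightarrow> nat \<Rightarrow> nat \<Rightarrow> bool"
  where "justified X e x y w \<longleftrightarrow>
    (pfst e = 0 \<and> y = 0) \<or>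
    (pfst e = 1 \<and> y = Suc (chd x)) \<or>
    (pfst e = 2 \<and> y = chd (cdrop (psnd e) x)) \<or>
    (pfst e = 3 \<and> X (pair 4 (pfst (psnd e))) x w \<and> X (psnd (psnd e)) w y) \<or>
    (pfst e = 4 \<and> psnd e = 0 \<and> y = 0) \<or>
    (pfst e = 4 \<and> psnd e \<noteq> 0 \<and> y \<noteq> 0 \<and>
      X (chd (psnd e)) x (chd y) \<and> X (pair 4 (ctl (psnd e))) x (ctl y)) \<or>
    (pfst e = 5 \<and> chd x = 0 \<and> X (pfst (psnd e)) (ctl x) y) \<or>
    (pfst e = 5 \<and> chd x \<noteq> 0 \<and> X e (ccons (chd x - Suc 0) (ctl x)) w \<and>
      X (psnd (psnd e)) (ccons (chd x - Suc 0) (ccons w (ctl x))) y) \<or>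
    (pfst e = 6 \<and> X (psnd e) (ccons y x) 0 \<and> X (pair 7 (psnd e)) (ccons y x) 0) \<or>
    (pfst e = 7 \<and> chd x = 0) \<or>
    (pfst e = 7 \<and> chd x \<noteq> 0 \<and> X e (ccons (chd x - Suc 0) (ctl x)) 0 \<and>
      X (psnd e) (ccons (chd x - Suc 0) (ctl x)) (Suc w))"

text \<open>
  Stage \<open>s\<close> tries the candidate \<open>s = pair (pair e (pair x y)) (pair w _)\<close>; the junk component makes
  every candidate come up at arbitrarily late stages.
\<close>

definition derived :: "nat \<Rightarrow> nat"
  where "derived s = rec_nat 0 (\<lambda>s F.
    if justified (\<lambda>e x y. cmem (pair e (pair x y)) F)
      (pfst (pfst s)) (pfst (psnd (pfst s))) (psnd (psnd (pfst s))) (pfst (psnd s))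
    then ccons (pfst s) F else F) s"

text \<open>Each stage holds a finite coded list, so the relation with a stage is decidable, while
  \<open>computes\<close> is recursively enumerable.\<close>

definition computes_in :: "nat \<Rightarrow> nat \<Rightarrow> nat \<Rightarrow> nat \<Rightarrow> bool"
  where "computes_in s e x y \<longleftrightarrow> cmem (pair e (pair x y)) (derived s)"

definition computes :: "nat \<Rightarrow> nat \<Rightarrow> nat \<Rightarrow> bool"
  where "computes e x y \<longleftrightarrow> (\<exists>s. computes_in s e x y)"

lemma total_rec_derived [rec_intros]:
  assumes "total_rec \<Phi> n a"
  shows "total_rec \<Phi> n (\<lambda>xs. derived (a xs))"
  unfolding derived_def justified_def by (intro rec_intros assms; simp)

lemma decidable_computes_in [rec_intros]:
  assumes "total_rec \<Phi> n s" "total_rec \<Phi> n e" "total_rec \<Phi> n x" "total_rec \<Phi> n y"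
  shows "decidable \<Phi> n (\<lambda>xs. computes_in (s xs) (e xs) (x xs) (y xs))"
  unfolding computes_in_def by (intro rec_intros assms)

lemma derived_0: "derived 0 = 0"
  by (simp add: derived_def)

lemma derived_Suc:
  "derived (Suc s) =
    (if justified (computes_in s)
      (pfst (pfst s)) (pfst (psnd (pfst s))) (psnd (psnd (pfst s))) (pfst (psnd s))
    then ccons (pfst s) (derived s) else derived s)"
  unfolding computes_in_def by (simp add: derived_def)

lemma computes_in_mono: "s \<le> t \<Longrightarrow> computes_in s e x y \<Longrightarrow> computes_in t e x y"
  by (induction rule: dec_induct) (auto simp: computes_in_def derived_Suc)

text \<open>\<open>X\<close> occurs only positively in \<open>justified\<close>.\<close>

lemma justified_mono:
  assumes "justified X e x y w" "\<And>e x y. X e x y \<Longrightarrow> Y e x y"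
  shows "justified Y e x y w"
  using assms(1) unfolding justified_def by (elim disjE conjE) (simp_all add: assms(2))

text \<open>Every rule has at most two premises, and the later of their two stages contains
  both.\<close>

lemma justified_stage:
  assumes "justified computes e x y w"
  shows "\<exists>s. justified (computes_in s) e x y w"
proof -
  have join: "\<exists>s. computes_in s e x y \<and> computes_in s e' x' y'"
    if "computes e x y" "computes e' x' y'" for e x y e' x' y'
    using that computes_in_mono unfolding computes_def by (metis nat_le_linear)
  have single: "\<exists>s. computes_in s e x y" if "computes e x y" for e x y
    using that by (simp add: computes_def)
  from assms show ?thesis
    unfolding justified_def by (elim disjE conjE) (simp_all add: join single)
qed

text \<open>\<open>computes\<close> is a fixed point of the rules: a derived triple was justified
  when it was added, and conversely a justified triple is tried again after its premises have
  appeared.\<close>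

lemma computes_iff: "computes e x y \<longleftrightarrow> (\<exists>w. justified computes e x y w)"
proof
  have "\<exists>w. justified computes e x y w" if "computes_in s e x y" for s
    using that
  proof (induction s)
    case 0
    then show ?case by (simp add: computes_in_def derived_0)
  next
    case (Suc s)
    show ?case
    proof (cases "computes_in s e x y")
      case False
      with Suc.prems have "pfst s = pair e (pair x y)"
        and "justified (computes_in s) (pfst (pfst s)) (pfst (psnd (pfst s)))
          (psnd (psnd (pfst s))) (pfst (psnd s))"
        by (auto simp: computes_in_def derived_Suc split: if_splits)
      then have "justified (computes_in s) e x y (pfst (psnd s))"
        by simp
      then show ?thesis
        using justified_mono computes_def by metis
    qed (rule Suc.IH)
  qed
  then show "computes e x y \<Longrightarrow> \<exists>w. justified computes e x y w"
    by (auto simp: computes_def)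
next
  assume "\<exists>w. justified computes e x y w"
  then obtain w s where "justified (computes_in s) e x y w"
    using justified_stage by blast
  \<comment> \<open>With \<open>s\<close> as the junk component, stage \<open>t\<close> tries this
    very triple and witness, and \<open>t\<close> is at least \<open>s\<close>.\<close>
  moreover define t where "t = pair (pair e (pair x y)) (pair w s)"
  moreover have "s \<le> t"
    unfolding t_def using le_pair_2 order_trans by blast
  ultimately have "justified (computes_in t) e x y w"
    using justified_mono computes_in_mono by blast
  then have "computes_in (Suc t) e x y"
    unfolding computes_in_def derived_Suc by (simp add: t_def)
  then show "computes e x y"
    by (auto simp: computes_def)
qed

text \<open>One unfolding of the fixed point gives each tag the defining equation of its
  scheme.\<close>

lemma computes_zero: "computes (pair 0 p) x y \<longleftrightarrow> y = 0"
  and computes_succ: "computes (pair 1 p) x y \<longleftrightarrow> y = Suc (chd x)"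
  and computes_proj: "computes (pair 2 p) x y \<longleftrightarrow> y = chd (cdrop p x)"
  and computes_comp:
    "computes (pair 3 (pair es e)) x y \<longleftrightarrow> (\<exists>w. computes (pair 4 es) x w \<and> computes e w y)"
  and computes_list_0: "computes (pair 4 0) x y \<longleftrightarrow> y = 0"
  and computes_list_ccons: "computes (pair 4 (ccons e es)) x y \<longleftrightarrow>
    (y \<noteq> 0 \<and> computes e x (chd y) \<and> computes (pair 4 es) x (ctl y))"
  and computes_rec_0: "computes (pair 5 (pair a b)) (ccons 0 x) y \<longleftrightarrow> computes a x y"
  and computes_rec_Suc: "computes (pair 5 (pair a b)) (ccons (Suc k) x) y \<longleftrightarrow>
    (\<exists>w. computes (pair 5 (pair a b)) (ccons k x) w \<and> computes b (ccons k (ccons w x)) y)"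
  and computes_mu: "computes (pair 6 a) x y \<longleftrightarrow>
    computes a (ccons y x) 0 \<and> computes (pair 7 a) (ccons y x) 0"
  and computes_below_0: "computes (pair 7 a) (ccons 0 x) y"
  and computes_below_Suc: "computes (pair 7 a) (ccons (Suc k) x) y \<longleftrightarrow>
    computes (pair 7 a) (ccons k x) 0 \<and> (\<exists>w. computes a (ccons k x) (Suc w))"
  by - (subst computes_iff, simp add: justified_def [abs_def])+

section \<open>Indices of the partial recursive functions\<close>

lemma computes_list:
  "computes (pair 4 (list_encode es)) x w \<longleftrightarrow>
    (\<exists>ys. w = list_encode ys \<and> list_all2 (\<lambda>e. computes e x) es ys)"
proof (induction es arbitrary: w)
  case Nil
  then show ?case by (simp add: computes_list_0)
next
  case (Cons e es)
  show ?case
  proof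
    assume "computes (pair 4 (list_encode (e # es))) x w"
    then obtain ys where "w \<noteq> 0" "computes e x (chd w)" "ctl w = list_encode ys"
      "list_all2 (\<lambda>e. computes e x) es ys"
      by (auto simp: computes_list_ccons Cons.IH)
    then show "\<exists>ys. w = list_encode ys \<and> list_all2 (\<lambda>e. computes e x) (e # es) ys"
      by (intro exI [of _ "chd w # ys"]) (simp flip: \<open>ctl w = list_encode ys\<close>)
  qed (auto simp: computes_list_ccons Cons.IH list_all2_Cons1)
qed

text \<open>Tag 7 acts as a predicate: its value \<open>y\<close> is arbitrary.\<close>

lemma computes_below:
  "computes (pair 7 a) (ccons m x) y \<longleftrightarrow> (\<forall>k<m. \<exists>w. computes a (ccons k x) (Suc w))"
  by (induction m arbitrary: y) (auto simp: computes_below_0 computes_below_Suc less_Suc_eq)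

lemma those_eq_Some_iff: "those xs = Some ys \<longleftrightarrow> list_all2 (\<lambda>x y. x = Some y) xs ys"
  by (induction xs arbitrary: ys) (auto simp: list_all2_Cons1 split: option.splits)

text \<open>Brings minimization into the form of tags 6 and 7, where the least zero is described by
  the definedness and positivity of all earlier values.\<close>

lemma mu_fun_eq_Some_iff:
  "mu_fun f xs = Some y \<longleftrightarrow> f (y # xs) = Some 0 \<and> (\<forall>k<y. \<exists>w. f (k # xs) = Some (Suc w))"
proof
  assume *: "mu_fun f xs = Some y"
  then obtain n where n: "f (n # xs) = Some 0" "\<forall>m<n. f (m # xs) \<noteq> None"
    and y: "y = (LEAST n. f (n # xs) = Some 0)"
    by (auto simp: mu_fun_def split: if_splits)
  have "f (y # xs) = Some 0" "y \<le> n"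
    unfolding y using n(1) by (auto intro: LeastI Least_le)
  moreover have "f (k # xs) \<noteq> Some 0" if "k < y" for k
    using that not_less_Least unfolding y by blast
  ultimately show "f (y # xs) = Some 0 \<and> (\<forall>k<y. \<exists>w. f (k # xs) = Some (Suc w))"
    using n(2) by (metis not0_implies_Suc not_Some_eq order_less_le_trans)
next
  assume *: "f (y # xs) = Some 0 \<and> (\<forall>k<y. \<exists>w. f (k # xs) = Some (Suc w))"
  then have "(LEAST n. f (n # xs) = Some 0) = y"
    by (intro Least_equality) (auto simp flip: not_less)
  moreover have "\<exists>n. f (n # xs) = Some 0 \<and> (\<forall>m<n. f (m # xs) \<noteq> None)"
    using * by (intro exI [of _ y]) auto
  ultimately show "mu_fun f xs = Some y"
    by (simp add: mu_fun_def)
qed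

text \<open>The stages of the diagonalization run through all indices, so every partial recursive
  function must have one; it is assembled along the Kleene schemes. The equivalence for every
  \<open>y\<close> makes divergence agree as well.\<close>

lemma partial_rec_index:
  assumes "partial_rec_in {} n f"
  shows "\<exists>e. \<forall>xs y. length xs = n \<longrightarrow> (computes e (list_encode xs) y \<longleftrightarrow> f xs = Some y)"
  using assms
proof induction
  case (zero n)
  show ?case by (intro exI [of _ "pair 0 0"]) (auto simp: computes_zero)
next
  case succ
  show ?case
    by (intro exI [of _ "pair 1 0"]) (auto simp: computes_succ [unfolded One_nat_def] length_Suc_conv)
next
  case (proj i n)
  then show ?case by (intro exI [of _ "pair 2 i"]) (auto simp: computes_proj chd_cdrop)
next
  case (oracle_call h)
  then show ?case by simp
next
  case (comp gs f n)
  obtain e where e: "\<And>xs y. length xs = length gs \<Longrightarrow> computes e (list_encode xs) y \<longleftrightarrow> f xs = Some y"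
    using comp.IH by blast
  have "\<forall>g \<in> set gs. \<exists>e. \<forall>xs y. length xs = n \<longrightarrow> (computes e (list_encode xs) y \<longleftrightarrow> g xs = Some y)"
    using comp by blast
  then obtain E where E: "\<forall>g \<in> set gs. \<forall>xs y. length xs = n \<longrightarrow>
      (computes (E g) (list_encode xs) y \<longleftrightarrow> g xs = Some y)"
    by (rule bchoice [THEN exE])
  show ?case
  proof (intro exI [of _ "pair 3 (pair (list_encode (map E gs)) e)"] allI impI)
    fix xs :: "nat list" and y
    assume xs: "length xs = n"
    have "list_all2 (\<lambda>e. computes e (list_encode xs)) (map E gs) ys \<longleftrightarrow>
        those (map (\<lambda>g. g xs) gs) = Some ys" for ys
      unfolding those_eq_Some_iff list_all2_map1 using E xs
      by (auto simp: list_all2_conv_all_nth)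
    moreover have "length ys = length gs" if "those (map (\<lambda>g. g xs) gs) = Some ys" for ys
      using that unfolding those_eq_Some_iff by (auto dest: list_all2_lengthD)
    ultimately show "computes (pair 3 (pair (list_encode (map E gs)) e)) (list_encode xs) y \<longleftrightarrow>
        comp_fun f gs xs = Some y"
      by (auto simp: computes_comp computes_list comp_fun_def bind_eq_Some_conv e)
  qed
next
  case (prim_rec n f g)
  obtain a where a: "\<And>xs y. length xs = n \<Longrightarrow> computes a (list_encode xs) y \<longleftrightarrow> f xs = Some y"
    using prim_rec.IH(1) by blast
  obtain b where b: "\<And>xs y. length xs = n + 2 \<Longrightarrow> computes b (list_encode xs) y \<longleftrightarrow> g xs = Some y"
    using prim_rec.IH(2) by blast
  have "computes (pair 5 (pair a b)) (ccons k (list_encode xs)) y \<longleftrightarrow> prim_rec_fun f g k xs = Some y"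
    if "length xs = n" for k xs y
  proof (induction k arbitrary: y)
    case 0
    then show ?case using that by (simp add: computes_rec_0 a)
  next
    case (Suc k)
    have "computes b (ccons k (ccons w (list_encode xs))) y \<longleftrightarrow> g (k # w # xs) = Some y" for w
      using b [of "k # w # xs"] that by simp
    then show ?case by (simp add: computes_rec_Suc Suc.IH bind_eq_Some_conv)
  qed
  then show ?case
    by (intro exI [of _ "pair 5 (pair a b)"]) (auto simp: length_Suc_conv)
next
  case (mu n f)
  then obtain a where a: "\<And>xs y. length xs = n + 1 \<Longrightarrow> computes a (list_encode xs) y \<longleftrightarrow> f xs = Some y"
    by blast
  have "computes a (ccons k (list_encode xs)) y \<longleftrightarrow> f (k # xs) = Some y" if "length xs = n" for k xs y
    using a [of "k # xs"] that by simp
  then show ?case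
    by (intro exI [of _ "pair 6 a"])
      (auto simp: computes_mu computes_below mu_fun_eq_Some_iff)
qed

lemma partial_rec_unary_index:
  assumes "partial_rec_in {} 1 f"
  obtains e where "\<And>x y. computes e (ccons x 0) y \<longleftrightarrow> f [x] = Some y"
proof -
  obtain e where e: "\<And>xs y. length xs = 1 \<Longrightarrow> computes e (list_encode xs) y \<longleftrightarrow> f xs = Some y"
    using partial_rec_index [OF assms] by blast
  have "computes e (ccons x 0) y \<longleftrightarrow> f [x] = Some y" for x y
    using e [of "[x]"] by simp
  then show ?thesis using that by blast
qed

section \<open>The diagonal construction\<close>

definition collides :: "nat \<Rightarrow> nat \<Rightarrow> nat \<Rightarrow> nat \<Rightarrow> nat \<Rightarrow> nat \<Rightarrow> bool"
  where "collides e b x y v s \<longleftrightarrow> b \<le> x \<and> x < y \<and>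
    computes_in s e (ccons x 0) v \<and> computes_in s e (ccons y 0) v"

text \<open>The two points, their common value and a stage are packed into one number, so that a
  single unbounded search finds them.\<close>

definition collision :: "nat \<Rightarrow> nat \<Rightarrow> nat \<Rightarrow> bool"
  where "collision e b w \<longleftrightarrow>
    collides e b (pfst (pfst w)) (psnd (pfst w)) (pfst (psnd w)) (psnd (psnd w))"

definition has_collision :: "nat \<Rightarrow> nat \<Rightarrow> bool"
  where "has_collision e b \<longleftrightarrow> (\<exists>w. collision e b w)"

definition halts :: "nat \<Rightarrow> nat \<Rightarrow> bool"
  where "halts e x \<longleftrightarrow> (\<exists>y. computes e (ccons x 0) y)"

text \<open>Questions \<open>pair 0 _\<close> ask for a collision, all other ones for convergence.\<close>

definition answer_witness :: "nat \<Rightarrow> nat \<Rightarrow> bool"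
  where "answer_witness q w \<longleftrightarrow>
    pfst q = 0 \<and> collision (pfst (psnd q)) (psnd (psnd q)) w \<or>
    pfst q \<noteq> 0 \<and> computes_in (pfst w) (pfst (psnd q)) (ccons (psnd (psnd q)) 0) (psnd w)"

text \<open>Both kinds of questions go into one set because \<open>Delta_2_0\<close> allows a single
  recursively enumerable oracle.\<close>

definition answer_set :: "word set"
  where "answer_set = {v. \<exists>w. answer_witness (word_rank v) w}"

text \<open>
  The search for a collision also accepts anything if there is none, so that it always succeeds.
\<close>

definition next_bound :: "nat \<Rightarrow> nat \<Rightarrow> nat"
  where "next_bound e b =
    (if has_collision e b
     then Suc (psnd (pfst (LEAST w. collision e b w \<or> \<not> has_collision e b)))
     else Suc (Suc (b + b)))"

definition bound :: "nat \<Rightarrow> nat"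
  where "bound e = rec_nat 0 next_bound e"

text \<open>\<open>Suc x = bound (Suc e)\<close> singles out the last point of the stage: the larger
  colliding point if there is a collision, and otherwise the point \<open>2 b + 1\<close> that keeps
  the set infinite.\<close>

definition selected :: "nat \<Rightarrow> nat \<Rightarrow> bool"
  where "selected e x \<longleftrightarrow> bound e \<le> x \<and> x < bound (Suc e) \<and>
    (has_collision e (bound e) \<or> Suc x = bound (Suc e) \<or> \<not> halts e x)"

text \<open>The bounded quantifier keeps membership decidable in the oracle;
  \<open>mem_diagonal_set\<close> removes the bound, using \<open>e \<le> bound e\<close>.\<close>

definition diagonal_set :: "word set"
  where "diagonal_set = {v. \<exists>e<Suc (word_rank v). selected e (word_rank v)}"

section \<open>Membership of the diagonal set in \<open>Delta_2_0\<close>\<close>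

lemma decidable_collision [rec_intros]:
  assumes "total_rec \<Phi> n e" "total_rec \<Phi> n b" "total_rec \<Phi> n w"
  shows "decidable \<Phi> n (\<lambda>xs. collision (e xs) (b xs) (w xs))"
  unfolding collision_def collides_def by (intro rec_intros assms)

lemma decidable_answer_witness:
  "decidable \<Phi> n (\<lambda>xs. answer_witness (a xs) (b xs))"
  if "total_rec \<Phi> n a" "total_rec \<Phi> n b"
  unfolding answer_witness_def by (intro rec_intros that)

lemma surj_word_rank: "\<exists>v. word_rank v = n"
  using bij_word_rank by (metis bij_pointE)

lemma word_rank_inv [simp]: "word_rank (inv word_rank n) = n"
  using bij_word_rank by (simp add: bij_is_surj surj_f_inv_f)

lemma rec_enumerable_dom:
  assumes "partial_rec_in {} 1 \<phi>"
  shows "rec_enumerable {v. \<phi> [word_rank v] \<noteq> None}"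
  unfolding rec_enumerable_def
proof (intro bexI)
  let ?f = "\<lambda>v. map_option (inv word_rank) (\<phi> [word_rank v])"
  show "dom ?f = {v. \<phi> [word_rank v] \<noteq> None}"
    by auto
  show "?f \<in> F_PR"
    unfolding F_PR_def using assms by (auto simp: option.map_comp comp_def option.map_ident)
qed

lemma rec_enumerable_answer_set: "rec_enumerable answer_set"
proof -
  have "decidable {} (1 + 1) (\<lambda>ys. answer_witness (drop 1 ys ! 0) (ys ! 0))"
    by (intro decidable_answer_witness rec_intros; simp)
  then obtain \<phi> where \<phi>: "partial_rec_in {} 1 \<phi>"
      "\<And>xs. length xs = 1 \<Longrightarrow> \<phi> xs = (if \<exists>w. answer_witness (xs ! 0) w
        then Some (LEAST w. answer_witness (xs ! 0) w) else None)"
    using partial_rec_search [of "{}" 1 "\<lambda>xs. answer_witness (xs ! 0)"] by blast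
  have "{v. \<phi> [word_rank v] \<noteq> None} = answer_set"
    by (auto simp: answer_set_def \<phi>(2))
  with rec_enumerable_dom [OF \<phi>(1)] show ?thesis by simp
qed

lemma char_fun_Collect: "char_fun {v. P (word_rank v)} n = (if P n then 1 else 0)"
  using surj_word_rank [of n] by (auto simp: char_fun_def)

lemma char_fun_answer_set:
  "char_fun answer_set q = (if \<exists>w. answer_witness q w then 1 else 0)"
  unfolding answer_set_def by (rule char_fun_Collect)

lemma has_collision_iff: "has_collision e b \<longleftrightarrow> char_fun answer_set (pair 0 (pair e b)) = 1"
  by (simp add: char_fun_answer_set answer_witness_def has_collision_def)

lemma halts_iff: "halts e x \<longleftrightarrow> char_fun answer_set (pair 1 (pair e x)) = 1"
proof -
  have "halts e x \<longleftrightarrow> (\<exists>w. computes_in (pfst w) e (ccons x 0) (psnd w))"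
    unfolding halts_def computes_def by (metis pfst_pair psnd_pair)
  then show ?thesis
    by (simp add: char_fun_answer_set answer_witness_def)
qed

lemma
  assumes "total_rec {char_fun answer_set} n e" "total_rec {char_fun answer_set} n b"
  shows decidable_has_collision: "decidable {char_fun answer_set} n (\<lambda>xs. has_collision (e xs) (b xs))"
    and decidable_halts: "decidable {char_fun answer_set} n (\<lambda>xs. halts (e xs) (b xs))"
  unfolding has_collision_iff halts_iff by (intro rec_intros total_rec_oracle [of "char_fun answer_set"] assms; simp)+

lemma total_rec_bound:
  assumes "total_rec {char_fun answer_set} n a"
  shows "total_rec {char_fun answer_set} n (\<lambda>xs. bound (a xs))"
proof -
  have "total_rec {char_fun answer_set} 2 (\<lambda>xs. next_bound (xs ! 0) (xs ! 1))"
    unfolding next_bound_def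
    \<comment> \<open>Among the goals left is that the search always succeeds: a collision is a
      witness if there is one, and otherwise every number is.\<close>
    by (intro rec_intros decidable_has_collision) (auto simp: has_collision_def)
  then have "total_rec {char_fun answer_set} (n + 2) (\<lambda>xs. next_bound (xs ! 0) (xs ! 1))"
    by (rule total_rec_comp2) (intro rec_intros; simp)+
  then show ?thesis
    unfolding bound_def by (intro rec_intros assms)
qed

lemma diagonal_set_reducible: "diagonal_set \<le>\<^sub>T answer_set"
proof -
  have "decidable {char_fun answer_set} 1 (\<lambda>xs. \<exists>e<Suc (xs ! 0). selected e (xs ! 0))"
    unfolding selected_def
    by (intro rec_intros decidable_has_collision decidable_halts total_rec_bound; simp)
  then obtain \<phi> where "partial_rec_in {char_fun answer_set} 1 \<phi>"
      "\<And>xs. length xs = 1 \<Longrightarrow> \<phi> xs = Some (if \<exists>e<Suc (xs ! 0). selected e (xs ! 0) then 1 else 0)"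
    by (auto simp: decidable_def total_rec_def)
  then show ?thesis
    unfolding turing_reducible_def diagonal_set_def
      char_fun_Collect [of "\<lambda>n. \<exists>e<Suc n. selected e n"]
    by (intro exI [of _ \<phi>]) simp
qed

lemma diagonal_set_Delta_2_0: "diagonal_set \<in> Delta_2_0"
  unfolding Delta_2_0_def using rec_enumerable_answer_set diagonal_set_reducible by blast

section \<open>Infinity and incompressibility of the diagonal set\<close>

lemma has_collisionI:
  assumes "b \<le> x" "x < y" "computes e (ccons x 0) v" "computes e (ccons y 0) v"
  shows "has_collision e b"
proof -
  obtain s t where "computes_in s e (ccons x 0) v" "computes_in t e (ccons y 0) v"
    using assms(3,4) by (auto simp: computes_def)
  then have "computes_in (max s t) e (ccons x 0) v" "computes_in (max s t) e (ccons y 0) v"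
    by (auto elim: computes_in_mono [rotated])
  then have "collision e b (pair (pair x y) (pair v (max s t)))"
    using assms(1,2) by (simp add: collision_def collides_def)
  then show ?thesis by (auto simp: has_collision_def)
qed

lemma bound_collisionE:
  assumes "has_collision e (bound e)"
  obtains x y v where "bound e \<le> x" "x < y" "bound (Suc e) = Suc y"
    "computes e (ccons x 0) v" "computes e (ccons y 0) v"
proof -
  define w where "w = (LEAST w. collision e (bound e) w)"
  have "collision e (bound e) w"
    unfolding w_def using assms LeastI_ex unfolding has_collision_def by metis
  \<comment> \<open>As a collision exists, the second disjunct of the search in
    \<open>next_bound\<close> is false and the search returns this same \<open>w\<close>.\<close>
  moreover have "bound (Suc e) = Suc (psnd (pfst w))"
    using assms by (simp add: bound_def next_bound_def w_def)
  ultimately show ?thesis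
    using that [of "pfst (pfst w)" "psnd (pfst w)"] by (auto simp: collision_def collides_def computes_def)
qed

lemma bound_no_collision: "\<not> has_collision e (bound e) \<Longrightarrow> bound (Suc e) = Suc (Suc (bound e + bound e))"
  by (simp add: bound_def next_bound_def)

lemma bound_less_Suc: "bound e < bound (Suc e)"
  by (cases "has_collision e (bound e)") (auto elim: bound_collisionE simp: bound_no_collision)

lemma strict_mono_bound: "strict_mono bound"
  by (simp add: strict_mono_Suc_iff bound_less_Suc)

lemma stage_unique:
  assumes "bound e \<le> x" "x < bound (Suc e)" "bound e' \<le> x" "x < bound (Suc e')"
  shows "e = e'"
proof -
  have "\<not> Suc i \<le> j" if "bound j \<le> x" "x < bound (Suc i)" for i j
    using that strict_mono_less_eq [OF strict_mono_bound, of "Suc i" j] by linarith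
  with assms show ?thesis by (metis not_less_eq_eq le_antisym)
qed

lemma mem_diagonal_set: "v \<in> diagonal_set \<longleftrightarrow> (\<exists>e. selected e (word_rank v))"
proof -
  have "e < Suc x" if "selected e x" for e x
    using that strict_mono_imp_increasing [OF strict_mono_bound, of e] by (simp add: selected_def)
  then show ?thesis by (auto simp: diagonal_set_def)
qed

lemma selected_last: "selected e (bound (Suc e) - 1)"
  using bound_less_Suc [of e] by (simp add: selected_def)

lemma infinite_diagonal_set: "infinite diagonal_set"
proof
  assume "finite diagonal_set"
  then obtain m where m: "\<And>v. v \<in> diagonal_set \<Longrightarrow> word_rank v < m"
    using finite_nat_set_iff_bounded [of "word_rank ` diagonal_set"] by auto
  \<comment> \<open>The last point of stage \<open>m\<close> is selected, and it is at least
    \<open>m\<close> because \<open>m \<le> bound m < bound (Suc m)\<close>.\<close>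
  obtain v where v: "word_rank v = bound (Suc m) - 1"
    using surj_word_rank by blast
  then have "v \<in> diagonal_set"
    using selected_last mem_diagonal_set by auto
  moreover have "m \<le> word_rank v"
    using strict_mono_imp_increasing [OF strict_mono_bound, of m] bound_less_Suc [of m] v by linarith
  ultimately show False using m by fastforce
qed

lemma selected_not_bijective:
  fixes g :: "nat \<Rightarrow> nat option"
  assumes g: "\<And>x y. computes e (ccons x 0) y \<longleftrightarrow> g x = Some y"
    and A: "A = {x. \<exists>e. selected e x}"
    and total: "A \<subseteq> dom g" and inj: "inj_on g A" and surj: "range Some \<subseteq> g ` A"
  shows False
proof (cases "has_collision e (bound e)")
  case True
  then obtain x y v where xy: "bound e \<le> x" "x < y" "bound (Suc e) = Suc y" "g x = Some v" "g y = Some v"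
    by (auto elim: bound_collisionE simp: g)
  \<comment> \<open>After a collision the whole stage is selected, and it ends exactly with
    \<open>y\<close>.\<close>
  then have "x \<in> A" "y \<in> A"
    using True by (auto simp: A selected_def intro!: exI [of _ e])
  with xy inj_onD [OF inj, of x y] show False by simp
next
  case False
  define b where "b = bound e"
  have next_b: "bound (Suc e) = Suc (Suc (b + b))"
    using bound_no_collision [OF False] by (simp add: b_def)
  have halts: "halts e x \<longleftrightarrow> x \<in> dom g" for x
    by (auto simp: halts_def g)
  \<comment> \<open>Without a collision \<open>g\<close> is injective on its domain from
    \<open>b\<close> on, also beyond this stage.\<close>
  have upper: "x = y" if "b \<le> x" "b \<le> y" "g x = Some v" "g y = Some v" for x y v
    using that False has_collisionI [of b x y e v] has_collisionI [of b y x e v]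
    unfolding b_def g by (meson nat_neq_iff)
  \<comment> \<open>A point of divergence would be selected, against the totality of
    \<open>g\<close> on \<open>A\<close>.\<close>
  have conv: "x \<in> dom g" if "x \<in> {b..b + b}" for x
  proof (rule ccontr)
    assume "x \<notin> dom g"
    with that have "selected e x"
      by (auto simp: selected_def halts next_b b_def [symmetric])
    with \<open>x \<notin> dom g\<close> total show False by (auto simp: A)
  qed
  have "inj_on g {b..b + b}"
    using conv upper by (intro inj_onI) (fastforce simp: dom_def)
  then have "card (g ` {b..b + b}) = Suc b"
    by (simp add: card_image)
  moreover have "card (g ` {..<b}) \<le> b"
    using card_image_le [of "{..<b}" g] by simp
  \<comment> \<open>Pigeonhole: \<open>b + 1\<close> distinct values cannot all be among the at most
    \<open>b\<close> results below \<open>b\<close>.\<close>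
  ultimately have "\<not> g ` {b..b + b} \<subseteq> g ` {..<b}"
    using card_mono [of "g ` {..<b}" "g ` {b..b + b}"] by auto
  then obtain x where x: "x \<in> {b..b + b}" "g x \<notin> g ` {..<b}"
    by blast
  obtain v where v: "g x = Some v"
    using conv [OF x(1)] by auto
  then obtain z where z: "z \<in> A" "g z = Some v"
    using surj by (metis image_iff rangeI subset_iff)
  \<comment> \<open>The value \<open>v\<close> is not taken below \<open>b\<close>, and from
    \<open>b\<close> on it is taken only at \<open>x\<close>, so \<open>x\<close> itself would have
    to lie in \<open>A\<close>.\<close>
  with x(2) v have "b \<le> z"
    by (metis image_eqI lessThan_iff not_less)
  then have "z = x"
    using x(1) z(2) v upper by auto
  with z(1) obtain e' where "selected e' x"
    by (auto simp: A)
  moreover from this have "e' = e"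
    using x(1) next_b by (intro stage_unique [of e' x e]) (auto simp: selected_def b_def)
  \<comment> \<open>In stage \<open>e\<close>, \<open>x \<le> 2 b\<close> is not the last point,
    \<open>g\<close> converges at it and there is no collision, so it is not selected.\<close>
  ultimately show False
    using False x(1) v by (auto simp: selected_def halts next_b)
qed

text \<open>A compression function, read on ranks through the bijection \<open>word_rank\<close>,
  would be a partial recursive bijection from the selected numbers onto all numbers.\<close>

lemma diagonal_set_not_compressible: "\<not> compressible F_PR diagonal_set"
proof
  assume "compressible F_PR diagonal_set"
  then obtain f where f: "f \<in> F_PR" and dom: "diagonal_set \<subseteq> dom f"
    and img: "f ` diagonal_set = range Some" and inj: "inj_on f diagonal_set"
    by (auto simp: compressible_def compression_function_def)
  from f obtain \<phi> where \<phi>: "partial_rec_in {} 1 \<phi>" "\<And>v. \<phi> [word_rank v] = map_option word_rank (f v)"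
    by (auto simp: F_PR_def)
  obtain e where e: "\<And>x y. computes e (ccons x 0) y \<longleftrightarrow> \<phi> [x] = Some y"
    using partial_rec_unary_index [OF \<phi>(1)] by blast
  have inj_rank: "inj word_rank"
    using bij_word_rank by (rule bij_is_inj)
  define A where "A = word_rank ` diagonal_set"
  have "A = {x. \<exists>e. selected e x}"
    unfolding A_def using mem_diagonal_set surj_word_rank by (auto simp: image_iff) metis
  moreover have "A \<subseteq> dom (\<lambda>x. \<phi> [x])"
    using dom by (auto simp: A_def \<phi>(2) dom_def)
  moreover have "inj_on (\<lambda>x. \<phi> [x]) A"
  proof (rule inj_onI)
    fix x y
    assume "x \<in> A" "y \<in> A" and eq: "\<phi> [x] = \<phi> [y]"
    then obtain u v where uv: "x = word_rank u" "y = word_rank v" "u \<in> diagonal_set" "v \<in> diagonal_set"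
      by (auto simp: A_def)
    with eq have "f u = f v"
      using option.inj_map [OF inj_rank] by (auto simp: \<phi>(2) dest: injD)
    with inj uv show "x = y" by (auto dest: inj_onD)
  qed
  moreover have "range Some \<subseteq> (\<lambda>x. \<phi> [x]) ` A"
  proof
    fix y :: "nat option"
    assume "y \<in> range Some"
    then obtain u where u: "y = Some (word_rank u)"
      using surj_word_rank by (metis imageE)
    obtain v where "v \<in> diagonal_set" "f v = Some u"
      using img by (metis imageE rangeI)
    then show "y \<in> (\<lambda>x. \<phi> [x]) ` A"
      by (auto simp: A_def \<phi>(2) u intro!: rev_image_eqI)
  qed
  ultimately show False
    by (rule selected_not_bijective [OF e])
qed

theorem theorem24:
  "\<not> Delta_2_0 \<subseteq> compressible' F_PR \<and>
   (\<exists>A \<in> Delta_2_0. infinite A \<and> \<not> compressible F_PR A)"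
  using diagonal_set_Delta_2_0 infinite_diagonal_set diagonal_set_not_compressible
  by (auto simp: compressible'_def)

end
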